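(* Let $\sigma>0$ and $P>0$, and let $\mathcal{G}$ be the Gaussian (AWGN) channel with noise standard deviation $\sigma$ and power constraint $P$. Then the deterministic identification capacity of $\mathcal{G}$ (in the $2^{nR\log n}$ scale) satisfies $$C_{DI}(\mathcal{G})\ \ge\ \frac{3}{8}.$$
   Context: Here $\log$ is the logarithm to base 2. The Gaussian channel $\mathcal{G}$ of block length $n$ maps an input $\mathbf{u}\in\mathbb{R}^n$ to the random output $\mathbf{Y}=\mathbf{u}+\sigma\mathbf{Z}$, where $\mathbf{Z}=(Z_1,\dots,Z_n)$ has i.i.d. standard normal components. For (measurable) $D\subseteq\mathbb{R}^n$, $P(D\mid\mathbf{u})$ denotes the probability that $\mathbf{u}+\sigma\mathbf{Z}\in D$. A deterministic identification (DI) code with parameters $(n,N,\lambda_1,\lambda_2)$ for $\mathcal{G}$ is a pair $(\mathcal{U},\mathcal{D})$, where $\mathcal{U}=\{\mathbf{u}_i: i\in\mathcal{M}\}\subset\mathbb{R}^n$, $\mathcal{M}=\{1,\dots,N\}$, is a family of codewords satisfying the power constraint $\|\mathbf{u}_i\|_2^2\le nP$ for all $i$, and $\mathcal{D}=\{D_i: i\in\mathcal{M}\}$ is a family of (measurable) decoding sets $D_i\subset\mathbb{R}^n$ (not required to be disjoint), such that $P(D_i^c\mid\mathbf{u}_i)\le\lambda_1$ for all $i\in\mathcal{M}$ (type I error) and $P(D_j\mid\mathbf{u}_i)\le\lambda_2$ for all $i\ne j$ in $\mathcal{M}$ (type II error). A rate $R$ is achievable if for all $\lambda_1,\lambda_2>0$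 and all sufficiently large $n$ there exists an $(n,N,\lambda_1,\lambda_2)$ DI code for $\mathcal{G}$ with $N=2^{nR\log n}$ (rounded down to an integer if necessary). The capacity $C_{DI}(\mathcal{G})$ is the supremum of all achievable rates. *)

theory Defs
  imports "HOL-Probability.Probability"
begin

text \<open>
  The block length varies inside the definition of achievability, so a point of \<open>\<real>\<^sup>n\<close> is
  an extensional function on the coordinates \<open>{..<n}\<close>, i.e. an element of
  \<open>space (euclid n)\<close>, which is \<open>{..<n} \<rightarrow>\<^sub>E UNIV\<close>.
\<close>

definition euclid :: "nat \<Rightarrow> (nat \<Rightarrow> real) measure" where
  "euclid n = Pi\<^sub>M {..<n} (\<lambda>_. borel)"

definition std_gaussian :: "nat \<Rightarrow> (nat \<Rightarrow> real) measure" where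
  "std_gaussian n = Pi\<^sub>M {..<n} (\<lambda>_. density lborel (\<lambda>x. ennreal (std_normal_density x)))"

text \<open>The law of \<open>u + \<sigma> Z\<close>.\<close>

definition gaussian_channel :: "real \<Rightarrow> nat \<Rightarrow> (nat \<Rightarrow> real) \<Rightarrow> (nat \<Rightarrow> real) measure" where
  "gaussian_channel \<sigma> n u = distr (std_gaussian n) (euclid n) (\<lambda>z. \<lambda>k\<in>{..<n}. u k + \<sigma> * z k)"

lemma sets_std_gaussian: "sets (std_gaussian n) = sets (euclid n)"
  unfolding std_gaussian_def euclid_def by (intro sets_PiM_cong) simp_all

lemma prob_space_std_gaussian: "prob_space (std_gaussian n)"
  unfolding std_gaussian_def
  by (intro prob_space_PiM prob_space_normal_density) simp

lemma measurable_affine_euclid [measurable]: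
  "(\<lambda>z. \<lambda>k\<in>{..<n}. u k + \<sigma> * z k) \<in> measurable (std_gaussian n) (euclid n)"
proof -
  have "(\<lambda>z. \<lambda>k\<in>{..<n}. u k + \<sigma> * z k) \<in> measurable (euclid n) (euclid n)"
    unfolding euclid_def by measurable
  then show ?thesis
    by (subst measurable_cong_sets[OF sets_std_gaussian refl])
qed

lemma prob_space_gaussian_channel: "prob_space (gaussian_channel \<sigma> n u)"
  unfolding gaussian_channel_def
  by (rule prob_space.prob_space_distr[OF prob_space_std_gaussian measurable_affine_euclid])

text \<open>
  \<open>U\<close> and \<open>D\<close> are indexed families; the decoding sets need not be disjoint.
\<close>

definition DI_code ::
  "real \<Rightarrow> real \<Rightarrow> nat \<Rightarrow> nat \<Rightarrow> real \<Rightarrow> real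
    \<Rightarrow> (nat \<Rightarrow> nat \<Rightarrow> real) \<Rightarrow> (nat \<Rightarrow> (nat \<Rightarrow> real) set) \<Rightarrow> bool" where
  "DI_code \<sigma> P n N l1 l2 U D \<longleftrightarrow>
    (\<forall>i\<in>{1..N}. U i \<in> space (euclid n) \<and> (L2_set (U i) {..<n})\<^sup>2 \<le> real n * P) \<and>
    (\<forall>i\<in>{1..N}. D i \<in> sets (euclid n)) \<and>
    (\<forall>i\<in>{1..N}. measure (gaussian_channel \<sigma> n (U i)) (space (euclid n) - D i) \<le> l1) \<and>
    (\<forall>i\<in>{1..N}. \<forall>j\<in>{1..N}. i \<noteq> j \<longrightarrow>
       measure (gaussian_channel \<sigma> n (U i)) (D j) \<le> l2)"

definition DI_achievable :: "real \<Rightarrow> real \<Rightarrow> real \<Rightarrow> bool" where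
  "DI_achievable \<sigma> P R \<longleftrightarrow>
    (\<forall>l1>0. \<forall>l2>0. \<forall>\<^sub>F n in sequentially.
       \<exists>U D. DI_code \<sigma> P n (nat \<lfloor>2 powr (real n * R * log 2 (real n))\<rfloor>) l1 l2 U D)"

text \<open>
  The supremum is taken in the extended reals, so that no boundedness of the set of
  achievable rates is presupposed. Negative \<open>R\<close> (with eventually no codewords at all) do not
  affect it, since \<open>R = 0\<close> is achievable for \<open>P \<ge> 0\<close> with a single codeword.
\<close>

definition DI_capacity :: "real \<Rightarrow> real \<Rightarrow> ereal" where
  "DI_capacity \<sigma> P = (SUP R\<in>{R. DI_achievable \<sigma> P R}. ereal R)"

end

theory Submission
  imports Defs "HOL-Real_Asymp.Real_Asymp"
begin

text \<open>
  The codewords are arranged in galaxies. Up to factors \<open>n\<^sup>\<beta>\<close>, the galaxy centres \<open>c\<close> lie at mutual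
  distance at least \<open>n\<^bsup>1/4\<^esup>\<close>, and the stars \<open>c + v\<close> of a galaxy lie on a sphere of radius at most
  \<open>n\<^bsup>1/4\<^esup>\<close> around \<open>c\<close>, at mutual distance at least \<open>n\<^bsup>1/8\<^esup>\<close>. The output \<open>y\<close> is accepted for \<open>u = c + v\<close> if
  \<open>\<parallel>y - u\<parallel>\<^sup>2\<close> is not much larger than \<open>n \<sigma>\<^sup>2\<close> and \<open>\<langle>y - u, - v\<rangle>\<close> is small. The first test fluctuates by
  \<open>n\<^bsup>1/2\<^esup>\<close> and rejects the other galaxies. If \<open>c + v'\<close> was sent, the inner product has mean
  \<open>\<langle>v' - v, - v\<rangle> = \<parallel>v' - v\<parallel>\<^sup>2 / 2\<close>, because \<open>\<parallel>v'\<parallel> = \<parallel>v\<parallel>\<close>, and standard deviation \<open>\<sigma> \<parallel>v\<parallel>\<close>, which is at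
  most of order \<open>n\<^bsup>1/4\<^esup>\<close>; so the second test rejects the other stars of the same galaxy, whatever their
  number. There are about \<open>n\<^bsup>n/4\<^esup>\<close> centres and \<open>n\<^bsup>n/8\<^esup>\<close> stars in each galaxy. Both packings are scaled
  Gilbert--Varshamov codes over the alphabet \<open>{0, ..., q - 1}\<close>.
\<close>

section \<open>Second-moment tail bounds for Gaussian noise\<close>

lemma integral_PiM_component:
  fixes f :: "'a \<Rightarrow> real"
  assumes N: "\<And>i. i \<in> I \<Longrightarrow> prob_space (N i)" and "i \<in> I" and f: "f \<in> borel_measurable (N i)"
  shows "(\<integral>x. f (x i) \<partial>Pi\<^sub>M I N) = integral\<^sup>L (N i) f"
    and "integrable (Pi\<^sub>M I N) (\<lambda>x. f (x i)) \<longleftrightarrow> integrable (N i) f"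
proof -
  have m: "(\<lambda>x. x i) \<in> measurable (Pi\<^sub>M I N) (N i)"
    using \<open>i \<in> I\<close> by measurable
  have d: "distr (Pi\<^sub>M I N) (N i) (\<lambda>x. x i) = N i"
    using N \<open>i \<in> I\<close> by (rule distr_PiM_component)
  show "(\<integral>x. f (x i) \<partial>Pi\<^sub>M I N) = integral\<^sup>L (N i) f"
    using integral_distr[OF m f] d by simp
  show "integrable (Pi\<^sub>M I N) (\<lambda>x. f (x i)) \<longleftrightarrow> integrable (N i) f"
    using integrable_distr_eq[OF m f] d by simp
qed

text \<open>Independent coordinates with mean zero make every cross term
  \<open>g i (x i) * g j (x j)\<close> integrate to zero, so the second moment of the sum is the sum
  of the second moments; Chebyshev's inequality does the rest.\<close>

lemma chebyshev_PiM_sum: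
  fixes N :: "'i \<Rightarrow> real measure" and g :: "'i \<Rightarrow> real \<Rightarrow> real"
  assumes I: "finite I" and N: "\<And>i. prob_space (N i)"
    and mg [measurable]: "\<And>i. i \<in> I \<Longrightarrow> g i \<in> borel_measurable (N i)"
    and int2: "\<And>i. i \<in> I \<Longrightarrow> integrable (N i) (\<lambda>x. (g i x)\<^sup>2)"
    and zero: "\<And>i. i \<in> I \<Longrightarrow> integral\<^sup>L (N i) (g i) = 0"
    and "a > 0"
  shows "measure (Pi\<^sub>M I N) {x \<in> space (Pi\<^sub>M I N). \<bar>\<Sum>i\<in>I. g i (x i)\<bar> \<ge> a}
           \<le> (\<Sum>i\<in>I. \<integral>x. (g i x)\<^sup>2 \<partial>N i) / a\<^sup>2"
proof -
  interpret product_prob_space N I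
    using N by (rule product_prob_spaceI)
  let ?M = "Pi\<^sub>M I N"
  interpret P: prob_space ?M
    using N by (intro prob_space_PiM)
  have int1: "integrable (N i) (g i)" if "i \<in> I" for i
  proof -
    show ?thesis using M.square_integrable_imp_integrable[OF mg[OF that] int2[OF that]] .
  qed
  have diag: "integrable ?M (\<lambda>x. g i (x i) * g i (x i))"
    "(\<integral>x. g i (x i) * g i (x i) \<partial>?M) = (\<integral>x. (g i x)\<^sup>2 \<partial>N i)" if "i \<in> I" for i
    using integral_PiM_component[of I N i "\<lambda>x. (g i x)\<^sup>2"] N that mg[OF that] int2[OF that]
    by (auto simp: power2_eq_square)
  have off: "integrable ?M (\<lambda>x. g i (x i) * g j (x j))"
    "(\<integral>x. g i (x i) * g j (x j) \<partial>?M) = 0" if "i \<in> I" "j \<in> I" "i \<noteq> j" for i j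
  proof -
    \<comment> \<open>Padding with the constant 1 outside \<open>{i, j}\<close> writes the cross
      term as a product over all of \<open>I\<close>, which the product integral formulas evaluate;
      the factor at \<open>i\<close> has integral zero.\<close>
    define F where "F = (\<lambda>m x. if m \<in> {i, j} then g m x else 1)"
    have F: "(\<lambda>x. \<Prod>m\<in>I. F m (x m)) = (\<lambda>x. g i (x i) * g j (x j))"
    proof
      fix x
      have "(\<Prod>m\<in>I. F m (x m)) = (\<Prod>m\<in>I \<inter> {i, j}. g m (x m))"
        unfolding F_def by (subst prod.inter_restrict[OF I]) (auto intro!: prod.cong)
      also have "I \<inter> {i, j} = {i, j}" using that by auto
      finally show "(\<Prod>m\<in>I. F m (x m)) = g i (x i) * g j (x j)" using that by simp
    qed
    have Fi: "integrable (N m) (F m)" if "m \<in> I" for m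
    proof -
        show ?thesis using int1[OF that] by (cases "m \<in> {i, j}") (simp_all add: F_def[abs_def])
    qed
    show "integrable ?M (\<lambda>x. g i (x i) * g j (x j))"
      using product_integrable_prod[OF I Fi] F by simp
    have "integral\<^sup>L (N i) (F i) = 0" using zero[OF that(1)] by (simp add: F_def)
    then show "(\<integral>x. g i (x i) * g j (x j) \<partial>?M) = 0"
      using product_integral_prod[OF I Fi] F that(1) I by auto
  qed
  have int: "integrable ?M (\<lambda>x. g i (x i) * g j (x j))" if "i \<in> I" "j \<in> I" for i j
    using diag(1) off(1) that by (cases "i = j") auto
  have "(\<integral>x. (\<Sum>i\<in>I. g i (x i))\<^sup>2 \<partial>?M) = (\<Sum>i\<in>I. \<Sum>j\<in>I. \<integral>x. g i (x i) * g j (x j) \<partial>?M)"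
    by (simp add: power2_eq_square sum_product int)
  also have "\<dots> = (\<Sum>i\<in>I. \<Sum>j\<in>I. if j = i then \<integral>x. (g i x)\<^sup>2 \<partial>N i else 0)"
    by (intro sum.cong refl) (auto simp: diag(2) off(2))
  also have "\<dots> = (\<Sum>i\<in>I. \<integral>x. (g i x)\<^sup>2 \<partial>N i)"
    using I by simp
  finally have E: "(\<integral>x. (\<Sum>i\<in>I. g i (x i))\<^sup>2 \<partial>?M) = (\<Sum>i\<in>I. \<integral>x. (g i x)\<^sup>2 \<partial>N i)" .
  have "integrable ?M (\<lambda>x. (\<Sum>i\<in>I. g i (x i))\<^sup>2)"
    by (simp add: power2_eq_square sum_product int)
  from P.second_moment_method[OF _ this \<open>a > 0\<close>] show ?thesis
    unfolding E by simp
qed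

lemma std_normal_moments:
  defines "G \<equiv> density lborel (\<lambda>x. ennreal (std_normal_density x))"
  shows "(\<integral>x. x \<partial>G) = 0" "(\<integral>x. x\<^sup>2 \<partial>G) = 1" "(\<integral>x. x ^ 4 \<partial>G) = 3"
    and "integrable G (\<lambda>x. x ^ k)"
  using integral_std_normal_distribution_moment_odd[of 1] std_normal_distribution_even_moments(1)[of 1]
    std_normal_distribution_even_moments(1)[of 2] integrable_std_normal_distribution_moment[of k]
  by (simp_all add: G_def fact_numeral)

lemma std_gaussian_linear_tail:
  assumes "a > 0"
  shows "measure (std_gaussian n) {z \<in> space (std_gaussian n). \<bar>\<Sum>k<n. w k * z k\<bar> \<ge> a}
           \<le> (\<Sum>k<n. (w k)\<^sup>2) / a\<^sup>2"
  using chebyshev_PiM_sum[where I="{..<n}" and g="\<lambda>k x. w k * x" and a = a and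
      N = "\<lambda>_. density lborel (\<lambda>x. ennreal (std_normal_density x))"] assms
    std_normal_moments(1,2) std_normal_moments(4)[of 2]
  by (simp add: std_gaussian_def prob_space_normal_density power_mult_distrib)

text \<open>The summands \<open>(z k)\<^sup>2 - 1\<close> are centred with variance 3 - 2 + 1 = 2,
  from the second and fourth normal moments.\<close>

lemma std_gaussian_norm_tail:
  assumes "a > 0"
  shows "measure (std_gaussian n) {z \<in> space (std_gaussian n). \<bar>(\<Sum>k<n. (z k)\<^sup>2) - real n\<bar> \<ge> a}
           \<le> 2 * real n / a\<^sup>2"
proof -
  define G where "G = density lborel (\<lambda>x. ennreal (std_normal_density x))"
  interpret prob_space G
    unfolding G_def by (simp add: prob_space_normal_density)
  note m = std_normal_moments[folded G_def]
  have sq: "(\<lambda>x. (x\<^sup>2 - 1)\<^sup>2) = (\<lambda>x::real. x ^ 4 - 2 * x\<^sup>2 + 1)"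
    by (auto simp: power2_eq_square power4_eq_xxxx algebra_simps)
  have i: "integrable G (\<lambda>x. (x\<^sup>2 - 1)\<^sup>2)" "integral\<^sup>L G (\<lambda>x. (x\<^sup>2 - 1)\<^sup>2) = 2"
    "integral\<^sup>L G (\<lambda>x. x\<^sup>2 - 1) = 0"
    unfolding sq using m(4)[of 4] m(4)[of 2] m(2,3) by (auto simp: prob_space)
  have [measurable_cong]: "sets G = sets borel"
    by (simp add: G_def)
  have "(\<lambda>x. x\<^sup>2 - 1 :: real) \<in> borel_measurable G"
    by measurable
  then show ?thesis
    using chebyshev_PiM_sum[where I="{..<n}" and g="\<lambda>k x. x\<^sup>2 - 1" and a = a and N = "\<lambda>_. G"]
      assms i prob_space_axioms
    by (simp add: std_gaussian_def G_def[symmetric] sum_subtractf mult.commute)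
qed

section \<open>Gilbert-Varshamov packings of words\<close>

text \<open>A maximal set of pairwise far points works: a point of \<open>S\<close> near none of its
  members could be added, so the balls around the members cover \<open>S\<close>.\<close>

lemma greedy_packing:
  fixes S :: "'a set"
  assumes "finite S" and refl: "\<And>x. x \<in> S \<Longrightarrow> near x x"
    and sym: "\<And>x y. near x y \<Longrightarrow> near y x"
    and ball: "\<And>x. x \<in> S \<Longrightarrow> card {y \<in> S. near x y} \<le> B"
  obtains C where "C \<subseteq> S" "\<And>x y. x \<in> C \<Longrightarrow> y \<in> C \<Longrightarrow> x \<noteq> y \<Longrightarrow> \<not> near x y"
    "card S \<le> card C * B"
proof -
  let ?F = "{C. C \<subseteq> S \<and> (\<forall>x\<in>C. \<forall>y\<in>C. x \<noteq> y \<longrightarrow> \<not> near x y)}"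
  have "finite ?F" "?F \<noteq> {}"
    using \<open>finite S\<close> by (auto intro!: exI[of _ "{}"])
  then obtain C where C: "C \<in> ?F" and max: "\<And>C'. C' \<in> ?F \<Longrightarrow> C \<subseteq> C' \<Longrightarrow> C = C'"
    using finite_has_maximal by (metis (no_types, lifting))
  have "S \<subseteq> (\<Union>x\<in>C. {y \<in> S. near x y})"
  proof
    fix y assume "y \<in> S"
    show "y \<in> (\<Union>x\<in>C. {y \<in> S. near x y})"
    proof (rule ccontr)
      assume far: "\<not> ?thesis"
      then have "insert y C \<in> ?F"
        using C \<open>y \<in> S\<close> sym by auto
      then have "y \<in> C" using max by blast
      then show False using far \<open>y \<in> S\<close> refl by auto
    qed
  qed
  then have "card S \<le> card (\<Union>x\<in>C. {y \<in> S. near x y})"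
    using C \<open>finite S\<close> by (intro card_mono) (auto intro: finite_subset)
  also have "\<dots> \<le> (\<Sum>x\<in>C. card {y \<in> S. near x y})"
    using C \<open>finite S\<close> by (intro card_UN_le) (auto intro: finite_subset)
  also have "\<dots> \<le> card C * B"
    using C ball sum_bounded_above[of C "\<lambda>x. card {y \<in> S. near x y}" B] by auto
  finally show thesis using C that by auto
qed

definition words :: "nat \<Rightarrow> nat \<Rightarrow> (nat \<Rightarrow> nat) set" where
  "words n q = {..<n} \<rightarrow>\<^sub>E {..<q}"

definition hamming :: "nat \<Rightarrow> (nat \<Rightarrow> nat) \<Rightarrow> (nat \<Rightarrow> nat) \<Rightarrow> nat" where
  "hamming n x y = card {k \<in> {..<n}. x k \<noteq> y k}"

lemma hamming_commute: "hamming n x y = hamming n y x"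
  unfolding hamming_def by (metis (no_types, lifting))

lemma finite_words [simp]: "finite (words n q)"
  by (simp add: words_def finite_PiE)

lemma card_words: "card (words n q) = q ^ n"
  by (simp add: words_def card_PiE)

text \<open>A word \<open>y\<close> is determined by the set \<open>D y\<close> where it disagrees
  with \<open>x\<close> and by its letters there. There are at most \<open>2 ^ n\<close> such sets,
  each with at most \<open>q ^ h\<close> fillings.\<close>

lemma card_hamming_ball:
  assumes "q > 0"
  shows "card {y \<in> words n q. hamming n x y < h} \<le> 2 ^ n * q ^ h"
proof -
  let ?B = "{y \<in> words n q. hamming n x y < h}"
  let ?As = "{A. A \<subseteq> {..<n} \<and> card A < h}"
  define D where "D = (\<lambda>y. {k \<in> {..<n}. x k \<noteq> y k})"
  let ?f = "\<lambda>y. (D y, restrict y (D y))"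
  have fin: "finite ?As" by auto
  have "inj_on ?f ?B"
  proof (rule inj_onI)
    fix y z assume yz: "y \<in> ?B" "z \<in> ?B" "?f y = ?f z"
    from yz(3) have eq: "D y = D z" "restrict y (D y) = restrict z (D z)"
      unfolding prod.inject by blast+
    show "y = z"
    proof
      fix k
      show "y k = z k"
      proof (cases "k < n")
        case True
        show ?thesis
        proof (cases "k \<in> D y")
          case True
          then show ?thesis using eq by (metis restrict_apply')
        next
          case False
          then have "k \<notin> D z" using eq(1) by simp
          then have "x k = z k" using \<open>k < n\<close> by (simp add: D_def)
          moreover have "x k = y k" using \<open>k \<notin> D y\<close> \<open>k < n\<close> by (simp add: D_def)
          ultimately show ?thesis by simp
        qed
      next
        case False
        \<comment> \<open>Off \<open>{..<n}\<close> both words take the default value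
          \<open>undefined\<close>, since words are extensional; agreement on the coordinates
          therefore gives equality.\<close>
        moreover have "y \<in> {..<n} \<rightarrow>\<^sub>E {..<q}" "z \<in> {..<n} \<rightarrow>\<^sub>E {..<q}"
          using yz(1,2) by (simp_all add: words_def)
        ultimately have "y k = undefined" "z k = undefined" by (meson PiE_arb lessThan_iff)+
        then show ?thesis by simp
      qed
    qed
  qed
  moreover have "?f ` ?B \<subseteq> (SIGMA A:?As. A \<rightarrow>\<^sub>E {..<q})"
  proof (rule image_subsetI)
    fix y assume y: "y \<in> ?B"
    have "D y \<subseteq> {..<n}" "card (D y) < h"
      using y by (simp_all add: D_def hamming_def subset_eq)
    moreover from this y have "restrict y (D y) \<in> D y \<rightarrow>\<^sub>E {..<q}"
      unfolding words_def by (intro restrict_PiE_iff[THEN iffD2] ballI) (blast dest: PiE_mem)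
    ultimately show "?f y \<in> (SIGMA A:?As. A \<rightarrow>\<^sub>E {..<q})" by blast
  qed
  moreover have "finite (SIGMA A:?As. A \<rightarrow>\<^sub>E {..<q})"
    using fin by (intro finite_SigmaI finite_PiE) (auto intro: finite_subset)
  ultimately have "card ?B \<le> card (SIGMA A:?As. A \<rightarrow>\<^sub>E {..<q})"
    by (rule card_inj_on_le)
  also have "\<dots> = (\<Sum>A\<in>?As. card (A \<rightarrow>\<^sub>E {..<q}))"
    using fin by (intro card_SigmaI) (auto intro: finite_subset finite_PiE)
  also have "\<dots> \<le> (\<Sum>A\<in>?As. q ^ h)"
  proof (rule sum_mono)
    fix A assume A: "A \<in> ?As"
    then have "finite A" by (auto intro: finite_subset)
    then show "card (A \<rightarrow>\<^sub>E {..<q}) \<le> q ^ h"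
      using A assms by (auto simp: card_PiE intro: power_increasing)
  qed
  also have "\<dots> \<le> card (Pow {..<n}) * q ^ h"
    using card_mono[of "Pow {..<n}" ?As] by (simp add: subset_eq)
  finally show ?thesis by (simp add: card_Pow)
qed

text \<open>The sum of squares takes at most \<open>n * q\<^sup>2 + 1\<close> values on words, so by the pigeonhole
  principle fixing it costs only a polynomial factor against the Gilbert--Varshamov bound.\<close>

lemma constant_norm_code:
  assumes "q > 0" "0 < h" "h \<le> n"
  obtains C m where "C \<subseteq> words n q"
    "\<And>x. x \<in> C \<Longrightarrow> (\<Sum>k<n. (x k)\<^sup>2) = m"
    "\<And>x y. x \<in> C \<Longrightarrow> y \<in> C \<Longrightarrow> x \<noteq> y \<Longrightarrow> h \<le> hamming n x y"
    "q ^ (n - h) \<le> card C * (2 ^ n * (n * q\<^sup>2 + 1))"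
proof -
  define w where "w = (\<lambda>x::nat \<Rightarrow> nat. \<Sum>k<n. (x k)\<^sup>2)"
  define S where "S = (\<lambda>m. {x \<in> words n q. w x = m})"
  have w: "w x \<le> n * q\<^sup>2" if "x \<in> words n q" for x
  proof -
    have "w x \<le> (\<Sum>k<n. q\<^sup>2)"
      unfolding w_def using that by (intro sum_mono power_mono) (auto simp: words_def dest!: PiE_mem)
    then show ?thesis by simp
  qed
  have "\<exists>m. q ^ n \<le> card (S m) * (n * q\<^sup>2 + 1)"
  proof (rule ccontr)
    assume "\<not> ?thesis"
    then have less: "card (S m) * (n * q\<^sup>2 + 1) < q ^ n" for m
      by (simp add: not_le)
    have "words n q = (\<Union>m\<in>{..n * q\<^sup>2}. S m)"
      using w by (auto simp: S_def)
    then have "q ^ n \<le> (\<Sum>m\<in>{..n * q\<^sup>2}. card (S m))"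
      using card_words[of n q] card_UN_le[of "{..n * q\<^sup>2}" S] by simp
    then have "q ^ n * (n * q\<^sup>2 + 1) \<le> (\<Sum>m\<in>{..n * q\<^sup>2}. card (S m) * (n * q\<^sup>2 + 1))"
      by (metis mult_le_mono1 sum_distrib_right)
    also have "\<dots> < (\<Sum>m\<in>{..n * q\<^sup>2}. q ^ n)"
      using less by (intro sum_strict_mono) auto
    finally show False by simp
  qed
  then obtain m where m: "q ^ n \<le> card (S m) * (n * q\<^sup>2 + 1)" ..
  have fin: "finite (S m)" by (simp add: S_def)
  have ball: "card {y \<in> S m. hamming n x y < h} \<le> 2 ^ n * q ^ h" for x
  proof -
    have "card {y \<in> S m. hamming n x y < h} \<le> card {y \<in> words n q. hamming n x y < h}"
      by (intro card_mono) (auto simp: S_def)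
    with card_hamming_ball[OF \<open>q > 0\<close>, of n x h] show ?thesis by linarith
  qed
  obtain C where C: "C \<subseteq> S m" "\<And>x y. x \<in> C \<Longrightarrow> y \<in> C \<Longrightarrow> x \<noteq> y \<Longrightarrow> \<not> hamming n x y < h"
    "card (S m) \<le> card C * (2 ^ n * q ^ h)"
  proof (rule greedy_packing[of "S m" "\<lambda>x y. hamming n x y < h", OF fin _ _ ball])
    show "hamming n x x < h" for x using \<open>h > 0\<close> by (simp add: hamming_def)
    show "hamming n y x < h" if "hamming n x y < h" for x y using that by (simp add: hamming_commute)
  qed blast
  \<comment> \<open>Cancelling the factor \<open>q ^ h\<close> of the ball bound is what shortens
    the exponent from \<open>n\<close> to \<open>n - h\<close>.\<close>
  have "q ^ h * q ^ (n - h) = q ^ n"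
    using \<open>h \<le> n\<close> by (simp flip: power_add)
  also have "\<dots> \<le> card C * (2 ^ n * q ^ h) * (n * q\<^sup>2 + 1)"
    using m C(3) by (meson le_trans mult_le_mono1)
  also have "\<dots> = q ^ h * (card C * (2 ^ n * (n * q\<^sup>2 + 1)))"
    by (simp only: mult_ac)
  finally have "q ^ (n - h) \<le> card C * (2 ^ n * (n * q\<^sup>2 + 1))"
    using \<open>q > 0\<close> by (metis mult_le_cancel1 zero_less_power)
  with C show thesis
    by (intro that[of C m]) (auto simp: S_def w_def not_less)
qed

section \<open>Error analysis of a galaxy code\<close>

lemma measure_gaussian_channel:
  assumes "A \<in> sets (euclid n)"
  shows "measure (gaussian_channel \<sigma> n u) A =
    measure (std_gaussian n) {z \<in> space (std_gaussian n). (\<lambda>k\<in>{..<n}. u k + \<sigma> * z k) \<in> A}"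
  unfolding gaussian_channel_def
  by (subst measure_distr[OF measurable_affine_euclid assms]) (simp add: vimage_def Int_def conj_commute)

text \<open>\<open>T\<close> is the slack of the norm test and \<open>\<tau>\<close> the threshold
  of the inner product test. The three error terms bound, in this order of appearance, an atypical
  noise norm, a large noise component along a star vector \<open>v j\<close>, and a large noise
  component along the difference of two codewords that are far apart. The factors 4 in the
  separation leave room for the noise on top of the thresholds.\<close>

lemma DI_code_galaxies:
  fixes c v :: "nat \<Rightarrow> nat \<Rightarrow> real"
  assumes "\<sigma> > 0" "T > 0" "\<tau> > 0"
    and power: "\<And>i. i \<in> {1..N} \<Longrightarrow> (\<Sum>k<n. (c i k + v i k)\<^sup>2) \<le> real n * P"
    and norm: "\<And>i. i \<in> {1..N} \<Longrightarrow> (\<Sum>k<n. (v i k)\<^sup>2) = \<rho>"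
    and sep: "\<And>i j. i \<in> {1..N} \<Longrightarrow> j \<in> {1..N} \<Longrightarrow> i \<noteq> j \<Longrightarrow>
      (\<forall>k<n. c i k = c j k) \<and> 4 * \<tau> \<le> (\<Sum>k<n. (v i k - v j k)\<^sup>2) \<or>
      4 * T \<le> (\<Sum>k<n. (c i k + v i k - (c j k + v j k))\<^sup>2)"
    and l1: "2 * real n * \<sigma> ^ 4 / T\<^sup>2 + \<sigma>\<^sup>2 * \<rho> / \<tau>\<^sup>2 \<le> l1"
    and l2: "\<sigma>\<^sup>2 * \<rho> / \<tau>\<^sup>2 \<le> l2" "2 * real n * \<sigma> ^ 4 / T\<^sup>2 + 4 * \<sigma>\<^sup>2 / T \<le> l2"
  shows "\<exists>U D. DI_code \<sigma> P n N l1 l2 U D"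
proof -
  let ?M = "std_gaussian n"
  interpret prob_space ?M by (rule prob_space_std_gaussian)
  have [measurable_cong]: "sets ?M = sets (Pi\<^sub>M {..<n} (\<lambda>_. borel))"
    by (simp add: sets_std_gaussian euclid_def)
  define U where "U = (\<lambda>i. \<lambda>k\<in>{..<n}. c i k + v i k)"
  \<comment> \<open>Both tests have only an upper threshold: a far codeword typically lengthens
    \<open>y - U j\<close>, and another star of the same galaxy typically raises the inner product
    with \<open>- v j\<close>, the direction from the star to its centre.\<close>
  define D where "D = (\<lambda>j. {y \<in> space (euclid n). (\<Sum>k<n. (y k - U j k)\<^sup>2) < real n * \<sigma>\<^sup>2 + T \<and>
      (\<Sum>k<n. (y k - U j k) * (- v j k)) < \<tau>})"
  have D [measurable]: "D j \<in> sets (euclid n)" for j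
    unfolding D_def euclid_def by measurable
  \<comment> \<open>The channel noise is \<open>\<sigma> * z k\<close>, so a deviation
    \<open>T / \<sigma>\<^sup>2\<close> here is a deviation \<open>T\<close> of its squared norm;
    likewise \<open>\<tau>\<close> becomes \<open>\<tau> / \<sigma>\<close> in the uses of
    \<open>F\<close> with a star vector below.\<close>
  define E where "E = {z \<in> space ?M. \<bar>(\<Sum>k<n. (z k)\<^sup>2) - real n\<bar> \<ge> T / \<sigma>\<^sup>2}"
  define F where "F = (\<lambda>w a. {z \<in> space ?M. \<bar>\<Sum>k<n. w k * z k\<bar> \<ge> a})"
  have [measurable]: "E \<in> events" "F w a \<in> events" for w a
    unfolding E_def F_def by measurable
  have E: "prob E \<le> 2 * real n * \<sigma> ^ 4 / T\<^sup>2"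
    using std_gaussian_norm_tail[of "T / \<sigma>\<^sup>2" n] \<open>T > 0\<close> \<open>\<sigma> > 0\<close>
    by (simp add: E_def power_divide)
  have F_star: "prob (F (v j) (\<tau> / \<sigma>)) \<le> \<sigma>\<^sup>2 * \<rho> / \<tau>\<^sup>2" if "j \<in> {1..N}" for j
    using std_gaussian_linear_tail[of "\<tau> / \<sigma>" n "v j"] \<open>\<tau> > 0\<close> \<open>\<sigma> > 0\<close> norm[OF that]
    by (simp add: F_def power_divide mult.commute)
  have not_E: "real n * \<sigma>\<^sup>2 - T < \<sigma>\<^sup>2 * (\<Sum>k<n. (z k)\<^sup>2) \<and> \<sigma>\<^sup>2 * (\<Sum>k<n. (z k)\<^sup>2) < real n * \<sigma>\<^sup>2 + T"
    if "z \<in> space ?M" "z \<notin> E" for z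
  proof -
    have "\<bar>(\<Sum>k<n. (z k)\<^sup>2) - real n\<bar> < T / \<sigma>\<^sup>2"
      using that by (simp add: E_def)
    then have "\<sigma>\<^sup>2 * \<bar>(\<Sum>k<n. (z k)\<^sup>2) - real n\<bar> < T"
      using \<open>\<sigma> > 0\<close> by (simp add: pos_less_divide_eq mult.commute)
    then have "\<bar>\<sigma>\<^sup>2 * ((\<Sum>k<n. (z k)\<^sup>2) - real n)\<bar> < T"
      by (simp add: abs_mult)
    then show ?thesis by (simp add: abs_less_iff algebra_simps)
  qed
  have type1: "measure (gaussian_channel \<sigma> n (U i)) (space (euclid n) - D i) \<le> l1" if i: "i \<in> {1..N}" for i
  proof -
    have "measure (gaussian_channel \<sigma> n (U i)) (space (euclid n) - D i) =
        prob {z \<in> space ?M. (\<lambda>k\<in>{..<n}. U i k + \<sigma> * z k) \<in> space (euclid n) - D i}"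
      by (rule measure_gaussian_channel) auto
    \<comment> \<open>When \<open>U i\<close> is sent, \<open>y - U i\<close> is the noise itself,
      so a failed test puts \<open>z\<close> into \<open>E\<close> or into \<open>F\<close> along
      \<open>v i\<close>.\<close>
    also have "\<dots> \<le> prob (E \<union> F (v i) (\<tau> / \<sigma>))"
    proof (rule finite_measure_mono)
      show "{z \<in> space ?M. (\<lambda>k\<in>{..<n}. U i k + \<sigma> * z k) \<in> space (euclid n) - D i} \<subseteq> E \<union> F (v i) (\<tau> / \<sigma>)"
      proof safe
        fix z assume z: "z \<in> space ?M" "z \<notin> F (v i) (\<tau> / \<sigma>)" "(\<lambda>k\<in>{..<n}. U i k + \<sigma> * z k) \<notin> D i"
          "(\<lambda>k\<in>{..<n}. U i k + \<sigma> * z k) \<in> space (euclid n)"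
        show "z \<in> E"
        proof (rule ccontr)
          assume "z \<notin> E"
          then have "\<sigma>\<^sup>2 * (\<Sum>k<n. (z k)\<^sup>2) < real n * \<sigma>\<^sup>2 + T"
            using not_E z(1) by blast
          moreover have "\<bar>\<Sum>k<n. v i k * z k\<bar> < \<tau> / \<sigma>"
            using z(1,2) by (simp add: F_def)
          then have "\<sigma> * \<bar>\<Sum>k<n. v i k * z k\<bar> < \<tau>"
            using \<open>\<sigma> > 0\<close> by (simp add: pos_less_divide_eq mult.commute)
          then have "\<bar>\<sigma> * (\<Sum>k<n. v i k * z k)\<bar> < \<tau>"
            using \<open>\<sigma> > 0\<close> by (simp add: abs_mult)
          then have "- (\<sigma> * (\<Sum>k<n. v i k * z k)) < \<tau>" by linarith
          ultimately have "(\<lambda>k\<in>{..<n}. U i k + \<sigma> * z k) \<in> D i"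
            using z(4) by (simp add: D_def power_mult_distrib sum_distrib_left sum_negf mult_ac)
          with z(3) show False by simp
        qed
      qed
    qed measurable
    also have "\<dots> \<le> prob E + prob (F (v i) (\<tau> / \<sigma>))"
      by (intro measure_Un_le) auto
    also have "\<dots> \<le> l1"
      using E F_star[OF i] l1 by linarith
    finally show ?thesis .
  qed
  have type2: "measure (gaussian_channel \<sigma> n (U i)) (D j) \<le> l2"
    if ij: "i \<in> {1..N}" "j \<in> {1..N}" "i \<noteq> j" for i j
  proof -
    let ?A = "{z \<in> space ?M. (\<lambda>k\<in>{..<n}. U i k + \<sigma> * z k) \<in> D j}"
    have eq: "measure (gaussian_channel \<sigma> n (U i)) (D j) = prob ?A"
      by (rule measure_gaussian_channel) auto
    have A: "(\<Sum>k<n. (c i k + v i k - (c j k + v j k) + \<sigma> * z k)\<^sup>2) < real n * \<sigma>\<^sup>2 + T"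
      "(\<Sum>k<n. (c i k + v i k - (c j k + v j k) + \<sigma> * z k) * (- v j k)) < \<tau>" if "z \<in> ?A" for z
      using that by (simp_all add: D_def U_def algebra_simps)
    consider (near) "\<forall>k<n. c i k = c j k" "4 * \<tau> \<le> (\<Sum>k<n. (v i k - v j k)\<^sup>2)"
      | (far) "4 * T \<le> (\<Sum>k<n. (c i k + v i k - (c j k + v j k))\<^sup>2)"
      using sep[OF ij] by blast
    then have "prob ?A \<le> l2"
    proof cases
      case near
      have "?A \<subseteq> F (v j) (\<tau> / \<sigma>)"
      proof
        fix z assume z: "z \<in> ?A"
        \<comment> \<open>Polarisation: the centres cancel, and the equal norms of
          \<open>v i\<close> and \<open>v j\<close> cancel after summation. The remaining mean is at
          least \<open>2 * \<tau>\<close>, so acceptance forces a noise term of at least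
          \<open>\<tau>\<close>. The resulting event depends on \<open>v j\<close> and not on
          \<open>v i\<close>.\<close>
        have "(\<Sum>k<n. (c i k + v i k - (c j k + v j k) + \<sigma> * z k) * (- v j k)) =
            (\<Sum>k<n. (v i k - v j k)\<^sup>2 / 2 + (v j k)\<^sup>2 / 2 - (v i k)\<^sup>2 / 2 - \<sigma> * (v j k * z k))"
          using near(1) by (intro sum.cong refl) (simp add: power2_eq_square field_simps)
        also have "\<dots> = (\<Sum>k<n. (v i k - v j k)\<^sup>2) / 2 - \<sigma> * (\<Sum>k<n. v j k * z k)"
          using norm[OF ij(1)] norm[OF ij(2)]
          by (simp add: sum.distrib sum_subtractf sum_distrib_left sum_divide_distrib[symmetric])
        finally have "\<tau> \<le> \<sigma> * (\<Sum>k<n. v j k * z k)"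
          using A(2)[OF z] near(2) by linarith
        then have "\<tau> / \<sigma> \<le> (\<Sum>k<n. v j k * z k)"
          using \<open>\<sigma> > 0\<close> by (simp add: pos_divide_le_eq mult.commute)
        then show "z \<in> F (v j) (\<tau> / \<sigma>)"
          using z by (simp add: F_def)
      qed
      then have "prob ?A \<le> prob (F (v j) (\<tau> / \<sigma>))"
        by (intro finite_measure_mono) auto
      then show ?thesis using F_star[OF ij(2)] l2(1) by linarith
    next
      case far
      define d where "d = (\<lambda>k. c i k + v i k - (c j k + v j k))"
      define q where "q = (\<Sum>k<n. (d k)\<^sup>2)"
      have q: "4 * T \<le> q" "q > 0" using far \<open>T > 0\<close> by (simp_all add: q_def d_def)
      \<comment> \<open>Outside \<open>F d (q / (4 * \<sigma>))\<close> the cross term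
        \<open>2 * \<sigma> * (\<Sum>k<n. d k * z k)\<close> exceeds \<open>- q / 2\<close>. Outside
        \<open>E\<close> as well, the squared distance to \<open>U j\<close> exceeds
        \<open>n * \<sigma>\<^sup>2 - T + q / 2\<close>, which is at least the threshold
        \<open>n * \<sigma>\<^sup>2 + T\<close> because \<open>4 * T \<le> q\<close>.\<close>
      have "?A \<subseteq> E \<union> F d (q / (4 * \<sigma>))"
      proof
        fix z assume z: "z \<in> ?A"
        show "z \<in> E \<union> F d (q / (4 * \<sigma>))"
        proof (rule ccontr)
          assume "\<not> ?thesis"
          then have zn: "z \<notin> E" "z \<notin> F d (q / (4 * \<sigma>))" by auto
          have "(\<Sum>k<n. (d k + \<sigma> * z k)\<^sup>2) =
              q + 2 * (\<sigma> * (\<Sum>k<n. d k * z k)) + \<sigma>\<^sup>2 * (\<Sum>k<n. (z k)\<^sup>2)"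
            by (simp add: q_def power2_sum power_mult_distrib sum.distrib sum_distrib_left mult_ac)
          moreover have "(\<Sum>k<n. (d k + \<sigma> * z k)\<^sup>2) < real n * \<sigma>\<^sup>2 + T"
            using A(1)[OF z] by (simp add: d_def)
          moreover have "real n * \<sigma>\<^sup>2 - T < \<sigma>\<^sup>2 * (\<Sum>k<n. (z k)\<^sup>2)"
            using not_E zn(1) z by blast
          moreover have "\<bar>\<Sum>k<n. d k * z k\<bar> < q / (4 * \<sigma>)"
            using zn(2) z by (simp add: F_def)
          then have "4 * (\<sigma> * \<bar>\<Sum>k<n. d k * z k\<bar>) < q"
            using \<open>\<sigma> > 0\<close> by (simp add: pos_less_divide_eq mult_ac)
          then have "4 * \<bar>\<sigma> * (\<Sum>k<n. d k * z k)\<bar> < q"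
            using \<open>\<sigma> > 0\<close> by (simp add: abs_mult)
          ultimately show False using q(1) by linarith
        qed
      qed
      then have "prob ?A \<le> prob (E \<union> F d (q / (4 * \<sigma>)))"
        by (intro finite_measure_mono) auto
      also have "\<dots> \<le> prob E + prob (F d (q / (4 * \<sigma>)))"
        by (intro measure_Un_le) auto
      also have "prob (F d (q / (4 * \<sigma>))) \<le> q / (q / (4 * \<sigma>))\<^sup>2"
        using std_gaussian_linear_tail[of "q / (4 * \<sigma>)" n d] q(2) \<open>\<sigma> > 0\<close> by (simp add: F_def q_def)
      \<comment> \<open>The signal \<open>q\<close> grows quadratically and the noise standard
        deviation linearly in the distance, so the bound decreases in \<open>q\<close> and the
        smallest case \<open>q = 4 * T\<close> covers all far pairs.\<close>
      also have "q / (q / (4 * \<sigma>))\<^sup>2 = 16 * \<sigma>\<^sup>2 / q"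
        using q(2) \<open>\<sigma> > 0\<close> by (simp add: field_simps power2_eq_square)
      also have "\<dots> \<le> 16 * \<sigma>\<^sup>2 / (4 * T)"
        using q \<open>T > 0\<close> by (intro divide_left_mono) auto
      also have "16 * \<sigma>\<^sup>2 / (4 * T) = 4 * \<sigma>\<^sup>2 / T" by simp
      finally show ?thesis using E l2(2) by linarith
    qed
    then show ?thesis using eq by simp
  qed
  have "U i \<in> space (euclid n) \<and> (L2_set (U i) {..<n})\<^sup>2 \<le> real n * P" if "i \<in> {1..N}" for i
    using power[OF that] by (simp add: U_def euclid_def space_PiM L2_set_def sum_nonneg)
  then have "DI_code \<sigma> P n N l1 l2 U D"
    using type1 type2 D by (simp add: DI_code_def)
  then show ?thesis by blast
qed

section \<open>Galaxy codes from two packings\<close>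

lemma hamming_mult_le_sum:
  fixes g :: "nat \<Rightarrow> real"
  assumes "\<And>k. k < n \<Longrightarrow> x k \<noteq> y k \<Longrightarrow> a \<le> g k" "\<And>k. k < n \<Longrightarrow> 0 \<le> g k"
  shows "real (hamming n x y) * a \<le> (\<Sum>k<n. g k)"
proof -
  have "real (hamming n x y) * a = (\<Sum>k\<in>{k \<in> {..<n}. x k \<noteq> y k}. a)"
    by (simp add: hamming_def)
  also have "\<dots> \<le> (\<Sum>k\<in>{k \<in> {..<n}. x k \<noteq> y k}. g k)"
    using assms(1) by (intro sum_mono) auto
  also have "\<dots> \<le> (\<Sum>k<n. g k)"
    using assms(2) by (intro sum_mono2) auto
  finally show ?thesis .
qed

lemma words_less: "x \<in> words n q \<Longrightarrow> k < n \<Longrightarrow> x k < q"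
  by (auto simp: words_def dest: PiE_mem)

lemma nat_diff_abs_ge_1: "(a :: nat) \<noteq> b \<Longrightarrow> 1 \<le> \<bar>real a - real b\<bar>"
  by linarith

text \<open>Centres are words over \<open>p\<close> letters scaled by \<open>s\<close>, stars are
  words over \<open>q\<close> letters scaled by \<open>r\<close>. By \<open>galaxy_small\<close>,
  star coordinates are at most half a centre step, so centres with different letters still give
  codewords \<open>s / 2\<close> apart in that coordinate; squaring this turns the required
  \<open>4 * T\<close> into \<open>16 * T\<close>.\<close>

lemma galaxy_code_exists:
  fixes s r :: real
  assumes pos: "\<sigma> > 0" "T > 0" "\<tau> > 0" "s \<ge> 0" "r \<ge> 0" "p > 0" "q > 0" and h: "0 < h" "h \<le> n"
    and power: "(s * real p + r * real q)\<^sup>2 \<le> P"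
    and galaxy_small: "r * real q \<le> s / 2"
    and galaxy_sep: "16 * T \<le> real h * s\<^sup>2"
    and star_sep: "4 * \<tau> \<le> real h * r\<^sup>2"
    and error: "2 * real n * \<sigma> ^ 4 / T\<^sup>2 + \<sigma>\<^sup>2 * (real n * (r * real q)\<^sup>2) / \<tau>\<^sup>2 + 4 * \<sigma>\<^sup>2 / T \<le> l"
    and l: "l \<le> l1" "l \<le> l2"
    and size: "N * (2 ^ n * (n * p\<^sup>2 + 1) * (2 ^ n * (n * q\<^sup>2 + 1))) \<le> (p * q) ^ (n - h)"
  shows "\<exists>U D. DI_code \<sigma> P n N l1 l2 U D"
proof -
  obtain X m' where X: "X \<subseteq> words n p" "\<And>x y. x \<in> X \<Longrightarrow> y \<in> X \<Longrightarrow> x \<noteq> y \<Longrightarrow> h \<le> hamming n x y"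
    "p ^ (n - h) \<le> card X * (2 ^ n * (n * p\<^sup>2 + 1))"
    using constant_norm_code[OF \<open>p > 0\<close> h] by metis
  obtain Y m where Y: "Y \<subseteq> words n q" "\<And>x. x \<in> Y \<Longrightarrow> (\<Sum>k<n. (x k)\<^sup>2) = m"
    "\<And>x y. x \<in> Y \<Longrightarrow> y \<in> Y \<Longrightarrow> x \<noteq> y \<Longrightarrow> h \<le> hamming n x y"
    "q ^ (n - h) \<le> card Y * (2 ^ n * (n * q\<^sup>2 + 1))"
    using constant_norm_code[OF \<open>q > 0\<close> h] by metis
  have "N * (2 ^ n * (n * p\<^sup>2 + 1) * (2 ^ n * (n * q\<^sup>2 + 1))) \<le> p ^ (n - h) * q ^ (n - h)"
    using size by (simp only: power_mult_distrib)
  also have "\<dots> \<le> card X * (2 ^ n * (n * p\<^sup>2 + 1)) * (card Y * (2 ^ n * (n * q\<^sup>2 + 1)))"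
    by (rule mult_le_mono[OF X(3) Y(4)])
  also have "\<dots> = card X * card Y * (2 ^ n * (n * p\<^sup>2 + 1) * (2 ^ n * (n * q\<^sup>2 + 1)))"
    by (simp only: mult_ac)
  finally have "N \<le> card X * card Y"
    by (simp only: mult_le_cancel2) simp
  then have "card {1..N} \<le> card (X \<times> Y)"
    by (simp add: card_cartesian_product)
  moreover have "finite (X \<times> Y)"
    using finite_subset[OF X(1)] finite_subset[OF Y(1)] by simp
  \<comment> \<open>Each message is assigned its own pair of a centre word and a star word.\<close>
  ultimately obtain f where f: "f ` {1..N} \<subseteq> X \<times> Y" "inj_on f {1..N}"
    using card_le_inj[of "{1..N}" "X \<times> Y"] by auto
  have fX: "fst (f i) \<in> X" and fY: "snd (f i) \<in> Y" if "i \<in> {1..N}" for i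
    using f(1) that by (auto simp: image_subset_iff mem_Times_iff)
  define c where "c = (\<lambda>i k. s * real (fst (f i) k))"
  define v where "v = (\<lambda>i k. r * real (snd (f i) k))"
  have word_bounds: "fst (f i) k < p" "snd (f i) k < q" if "i \<in> {1..N}" "k < n" for i k
    using fX[OF that(1)] fY[OF that(1)] X(1) Y(1) that(2) by (auto intro: words_less)
  have cb: "0 \<le> c i k" "c i k \<le> s * real p" and vb: "0 \<le> v i k" "v i k \<le> r * real q"
    if "i \<in> {1..N}" "k < n" for i k
    using word_bounds[OF that] \<open>s \<ge> 0\<close> \<open>r \<ge> 0\<close>
    by (simp_all add: c_def v_def mult_left_mono)
  have norm: "(\<Sum>k<n. (v i k)\<^sup>2) = r\<^sup>2 * real m" if "i \<in> {1..N}" for i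
    using arg_cong[OF Y(2)[OF fY[OF that]], of real]
    by (simp add: v_def power_mult_distrib sum_distrib_left[symmetric])
  show ?thesis
  proof (cases "N = 0")
    case True
    then show ?thesis by (auto simp: DI_code_def)
  next
    case False
    then have "1 \<in> {1..N}" by simp
    \<comment> \<open>As \<open>N\<close> is positive, message 1 supplies an actual star, whose
      coordinate bounds control the common squared norm.\<close>
    have "r\<^sup>2 * real m \<le> (\<Sum>k<n. (r * real q)\<^sup>2)"
      unfolding norm[OF \<open>1 \<in> {1..N}\<close>, symmetric]
      using vb[OF \<open>1 \<in> {1..N}\<close>] by (intro sum_mono power_mono) auto
    then have rho: "\<sigma>\<^sup>2 * (r\<^sup>2 * real m) / \<tau>\<^sup>2 \<le> \<sigma>\<^sup>2 * (real n * (r * real q)\<^sup>2) / \<tau>\<^sup>2"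
      using pos by (intro divide_right_mono mult_left_mono) auto
    have nonneg: "0 \<le> 2 * real n * \<sigma> ^ 4 / T\<^sup>2" "0 \<le> 4 * \<sigma>\<^sup>2 / T" "0 \<le> \<sigma>\<^sup>2 * (r\<^sup>2 * real m) / \<tau>\<^sup>2"
      using pos by simp_all
    show ?thesis
    proof (rule DI_code_galaxies[OF pos(1-3), where c = c and v = v])
      show "(\<Sum>k<n. (c i k + v i k)\<^sup>2) \<le> real n * P" if i: "i \<in> {1..N}" for i
      proof -
        have "(\<Sum>k<n. (c i k + v i k)\<^sup>2) \<le> (\<Sum>k<n. P)"
        proof (rule sum_mono)
          fix k assume "k \<in> {..<n}"
          then have "(c i k + v i k)\<^sup>2 \<le> (s * real p + r * real q)\<^sup>2"
            using cb[OF i, of k] vb[OF i, of k] by (intro power_mono) auto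
          then show "(c i k + v i k)\<^sup>2 \<le> P" using power by linarith
        qed
        then show ?thesis by simp
      qed
      show "(\<Sum>k<n. (v i k)\<^sup>2) = r\<^sup>2 * real m" if "i \<in> {1..N}" for i
        by (rule norm[OF that])
      show "(\<forall>k<n. c i k = c j k) \<and> 4 * \<tau> \<le> (\<Sum>k<n. (v i k - v j k)\<^sup>2) \<or>
          4 * T \<le> (\<Sum>k<n. (c i k + v i k - (c j k + v j k))\<^sup>2)"
        if ij: "i \<in> {1..N}" "j \<in> {1..N}" "i \<noteq> j" for i j
      proof (cases "fst (f i) = fst (f j)")
        case True
        then have "snd (f i) \<noteq> snd (f j)"
          using f(2) ij by (metis inj_onD prod.expand)
        then have "h \<le> hamming n (snd (f i)) (snd (f j))"
          using Y(3) fY ij by blast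
        then have "real h * r\<^sup>2 \<le> real (hamming n (snd (f i)) (snd (f j))) * r\<^sup>2"
          by (intro mult_right_mono) auto
        also have "\<dots> \<le> (\<Sum>k<n. (v i k - v j k)\<^sup>2)"
        proof (rule hamming_mult_le_sum)
          fix k assume "snd (f i) k \<noteq> snd (f j) k"
          then have "r\<^sup>2 * 1 \<le> r\<^sup>2 * \<bar>real (snd (f i) k) - real (snd (f j) k)\<bar>\<^sup>2"
            by (intro mult_left_mono one_le_power nat_diff_abs_ge_1) auto
          then show "r\<^sup>2 \<le> (v i k - v j k)\<^sup>2"
            by (simp add: v_def right_diff_distrib[symmetric] power_mult_distrib)
        qed simp
        finally have "4 * \<tau> \<le> (\<Sum>k<n. (v i k - v j k)\<^sup>2)" using star_sep by linarith
        then show ?thesis using True by (simp add: c_def)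
      next
        case False
        then have "h \<le> hamming n (fst (f i)) (fst (f j))"
          using X(2) fX ij by blast
        then have "real h * (s / 2)\<^sup>2 \<le> real (hamming n (fst (f i)) (fst (f j))) * (s / 2)\<^sup>2"
          by (intro mult_right_mono) auto
        also have "\<dots> \<le> (\<Sum>k<n. (c i k + v i k - (c j k + v j k))\<^sup>2)"
        proof (rule hamming_mult_le_sum)
          fix k assume k: "k < n" "fst (f i) k \<noteq> fst (f j) k"
          then have "s * 1 \<le> s * \<bar>real (fst (f i) k) - real (fst (f j) k)\<bar>"
            using \<open>s \<ge> 0\<close> by (intro mult_left_mono nat_diff_abs_ge_1) auto
          also have "\<dots> = \<bar>c i k - c j k\<bar>"
            using \<open>s \<ge> 0\<close> by (simp add: c_def right_diff_distrib[symmetric] abs_mult)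
          \<comment> \<open>Both star coordinates lie between 0 and \<open>s / 2\<close>, so their
            difference removes at most \<open>s / 2\<close> from the centre difference of at least
            \<open>s\<close>.\<close>
          finally have "s / 2 \<le> \<bar>c i k + v i k - (c j k + v j k)\<bar>"
            using vb[OF ij(1) k(1)] vb[OF ij(2) k(1)] galaxy_small by linarith
          then have "(s / 2)\<^sup>2 \<le> \<bar>c i k + v i k - (c j k + v j k)\<bar>\<^sup>2"
            using \<open>s \<ge> 0\<close> by (intro power_mono) auto
          then show "(s / 2)\<^sup>2 \<le> (c i k + v i k - (c j k + v j k))\<^sup>2" by simp
        qed simp
        finally show ?thesis using galaxy_sep by (simp add: power_divide)
      qed
    qed (use rho nonneg error l in linarith)+
  qed
qed

section \<open>Choice of parameters and the rate\<close>

lemma nat_ceiling_bounds: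
  assumes "1 \<le> (x :: real)"
  shows "x \<le> real (nat \<lceil>x\<rceil>)" "real (nat \<lceil>x\<rceil>) \<le> 2 * x"
  using assms by linarith+

text \<open>With \<open>h\<close> of order \<open>n\<close>, the squared distances have order
  \<open>n\<close> to the power 1/2 + 2\<beta> for centres and 1/4 + 2\<beta> for stars, while
  \<open>T\<close> and \<open>\<tau>\<close> have the exponents 1/2 + \<beta> and 1/4 + \<beta>. The
  spare factors absorb all constants, and the error terms vanish. The alphabets multiply to order
  \<open>n\<close> to the power 3/8 - 2\<beta>; a further 2\<beta> of rate pays for the losses of
  the packings.\<close>

lemma DI_achievable_galaxy:
  assumes "0 < \<beta>" "\<beta> < 1 / 8" and "\<sigma> > 0" "P > 0"
  shows "DI_achievable \<sigma> P (3 / 8 - 4 * \<beta>)"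
  unfolding DI_achievable_def
proof (intro allI impI)
  fix l1 l2 :: real
  assume "l1 > 0" "l2 > 0"
  define l where "l = min l1 l2"
  have "l > 0" using \<open>l1 > 0\<close> \<open>l2 > 0\<close> by (simp add: l_def)
  \<comment> \<open>\<open>K\<close> is the gap between the exponent provided by
    \<open>(a * b) ^ (n - h)\<close> with \<open>h \<le> \<beta> * n\<close> and the target rate.
    Since it is positive, \<open>n powr (n * K)\<close> outgrows the exponential and polynomial
    losses of both packings.\<close>
  define K where "K = (1 - \<beta>) * (3 / 8 - 2 * \<beta>) - (3 / 8 - 4 * \<beta>)"
  have "K = 13 / 8 * \<beta> + 2 * \<beta>\<^sup>2"
    by (simp add: K_def field_simps power2_eq_square)
  then have "K > 0" using \<open>0 < \<beta>\<close> by (simp add: add_pos_pos)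
  \<comment> \<open>In order: the power constraint, \<open>galaxy_small\<close>,
    \<open>galaxy_sep\<close>, \<open>star_sep\<close>, \<open>error\<close>, the losses in
    \<open>size\<close>, the rounding of \<open>h\<close>, and the bounds of \<open>p\<close> and
    \<open>q\<close> by \<open>n\<close>. The extra factors 2 allow for rounding the alphabet sizes
    up.\<close>
  have "\<forall>\<^sub>F n::nat in sequentially. real n powr (-1/4) \<le> sqrt P / 2"
    and "\<forall>\<^sub>F n::nat in sequentially. 8 * real n powr (-1/4) * real n powr (1/4 - \<beta>) \<le> sqrt P"
    and "\<forall>\<^sub>F n::nat in sequentially. 16 * (\<sigma>\<^sup>2 * real n powr (1/2 + \<beta>))
           \<le> (\<beta> / 2 * real n) * (sqrt P / (4 * real n powr (1/4 - \<beta>)))\<^sup>2"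
    and "\<forall>\<^sub>F n::nat in sequentially. 4 * (\<sigma> * real n powr (1/4 + \<beta>))
           \<le> (\<beta> / 2 * real n) * (real n powr (-1/4) / (2 * real n powr (1/8 - \<beta>)))\<^sup>2"
    and "\<forall>\<^sub>F n::nat in sequentially. 2 * real n * \<sigma> ^ 4 / (\<sigma>\<^sup>2 * real n powr (1/2 + \<beta>))\<^sup>2
           + \<sigma>\<^sup>2 * (real n * (real n powr (-1/4))\<^sup>2) / (\<sigma> * real n powr (1/4 + \<beta>))\<^sup>2
           + 4 * \<sigma>\<^sup>2 / (\<sigma>\<^sup>2 * real n powr (1/2 + \<beta>)) \<le> l"
    and "\<forall>\<^sub>F n::nat in sequentially. 4 ^ n * (2 * real n ^ 3)\<^sup>2 \<le> real n powr (real n * K)"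
    and "\<forall>\<^sub>F n::nat in sequentially. 1 + \<beta> / 2 * real n \<le> \<beta> * real n"
    and "\<forall>\<^sub>F n::nat in sequentially. 2 * real n powr (1/4 - \<beta>) \<le> real n"
    and "\<forall>\<^sub>F n::nat in sequentially. 2 * real n powr (1/8 - \<beta>) \<le> real n"
    using assms \<open>l > 0\<close> \<open>K > 0\<close> by real_asymp+
  with eventually_gt_at_top[of 0]
  show "\<forall>\<^sub>F n in sequentially. \<exists>U D.
    DI_code \<sigma> P n (nat \<lfloor>2 powr (real n * (3 / 8 - 4 * \<beta>) * log 2 (real n))\<rfloor>) l1 l2 U D"
  proof eventually_elim
    case (elim n)
    define a where "a = real n powr (1/4 - \<beta>)"
    define b where "b = real n powr (1/8 - \<beta>)"
    define p where "p = nat \<lceil>a\<rceil>"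
    define q where "q = nat \<lceil>b\<rceil>"
    \<comment> \<open>Starting from \<open>\<beta> / 2\<close> keeps \<open>h\<close> at most
      \<open>\<beta> * n\<close> after rounding up.\<close>
    define h where "h = nat \<lceil>\<beta> / 2 * real n\<rceil>"
    \<comment> \<open>The scalings make \<open>r * q\<close> equal to \<open>n powr (-1/4)\<close>,
      hence galaxy radii at most \<open>n powr (1/4)\<close>, and \<open>s * p\<close> equal to
      \<open>sqrt P / 2\<close>, so half of the amplitude \<open>sqrt P\<close> is left for the
      stars.\<close>
    define r where "r = real n powr (-1/4) / real q"
    define s where "s = sqrt P / (2 * real p)"
    define N where "N = nat \<lfloor>2 powr (real n * (3 / 8 - 4 * \<beta>) * log 2 (real n))\<rfloor>"
    have n: "real n \<ge> 1" "n > 0" using elim(1) by simp_all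
    have ab: "1 \<le> a" "1 \<le> b"
      using n assms by (simp_all add: a_def b_def ge_one_powr_ge_zero)
    have p: "a \<le> real p" "real p \<le> 2 * a" and q: "b \<le> real q" "real q \<le> 2 * b"
      unfolding p_def q_def by (rule nat_ceiling_bounds[OF ab(1)] nat_ceiling_bounds[OF ab(2)])+
    have pq: "p > 0" "q > 0"
      using ab p(1) q(1) by linarith+
    have "0 < \<beta> / 2 * real n" using n assms by simp
    then have h: "\<beta> / 2 * real n \<le> real h" "real h \<le> \<beta> * real n" "0 < h"
      using elim(8) unfolding h_def by linarith+
    have "\<beta> * real n \<le> 1 * real n" using assms by (intro mult_right_mono) auto
    then have "h \<le> n" using h(2) by simp
    have sp: "s * real p = sqrt P / 2" and rq: "r * real q = real n powr (-1/4)"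
      using pq by (simp_all add: s_def r_def)
    have s: "sqrt P / (4 * a) \<le> s"
      unfolding s_def using p pq assms by (intro divide_left_mono) auto
    have r: "real n powr (-1/4) / (2 * b) \<le> r"
      unfolding r_def using q pq ab by (intro divide_left_mono) auto
    have "\<exists>U D. DI_code \<sigma> P n N l1 l2 U D"
    proof (rule galaxy_code_exists[where T = "\<sigma>\<^sup>2 * real n powr (1/2 + \<beta>)" and \<tau> = "\<sigma> * real n powr (1/4 + \<beta>)"
          and s = s and r = r and p = p and q = q and h = h and l = l])
      show "\<sigma>\<^sup>2 * real n powr (1/2 + \<beta>) > 0" "\<sigma> * real n powr (1/4 + \<beta>) > 0" "s \<ge> 0" "r \<ge> 0"
        using n assms by (simp_all add: s_def r_def)
      have "s * real p + r * real q \<le> sqrt P"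
        using elim(2) by (simp add: sp rq)
      then have "(s * real p + r * real q)\<^sup>2 \<le> (sqrt P)\<^sup>2"
        using assms by (intro power_mono) (simp_all add: sp rq)
      then show "(s * real p + r * real q)\<^sup>2 \<le> P" using assms by simp
      have "8 * real n powr (-1/4) * a \<le> sqrt P"
        using elim(3) by (simp only: a_def)
      then have "real n powr (-1/4) \<le> (sqrt P / (4 * a)) / 2"
        using ab by (simp add: field_simps)
      also have "\<dots> \<le> s / 2"
        using s by (intro divide_right_mono) auto
      finally show "r * real q \<le> s / 2" unfolding rq .
      have "(\<beta> / 2 * real n) * (sqrt P / (4 * a))\<^sup>2 \<le> real h * s\<^sup>2"
        using h(1) s ab assms by (intro mult_mono power_mono) auto
      then show "16 * (\<sigma>\<^sup>2 * real n powr (1/2 + \<beta>)) \<le> real h * s\<^sup>2"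
        using elim(4) by (simp only: a_def[symmetric])
      have "(\<beta> / 2 * real n) * (real n powr (-1/4) / (2 * b))\<^sup>2 \<le> real h * r\<^sup>2"
        using h(1) r ab by (intro mult_mono power_mono) auto
      then show "4 * (\<sigma> * real n powr (1/4 + \<beta>)) \<le> real h * r\<^sup>2"
        using elim(5) by (simp only: b_def[symmetric])
      show "2 * real n * \<sigma> ^ 4 / (\<sigma>\<^sup>2 * real n powr (1/2 + \<beta>))\<^sup>2
          + \<sigma>\<^sup>2 * (real n * (r * real q)\<^sup>2) / (\<sigma> * real n powr (1/4 + \<beta>))\<^sup>2
          + 4 * \<sigma>\<^sup>2 / (\<sigma>\<^sup>2 * real n powr (1/2 + \<beta>)) \<le> l"
        using elim(6) by (simp only: rq)
      show "N * (2 ^ n * (n * p\<^sup>2 + 1) * (2 ^ n * (n * q\<^sup>2 + 1))) \<le> (p * q) ^ (n - h)"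
      proof -
        have poly: "real (n * x\<^sup>2 + 1) \<le> 2 * real n ^ 3" if "real x \<le> real n" for x
        proof -
          have "real n * (real x)\<^sup>2 \<le> real n * (real n)\<^sup>2"
            using that by (intro mult_left_mono power_mono) auto
          moreover have "1 \<le> real n ^ 3" using n by simp
          ultimately show ?thesis by (simp add: power2_eq_square power3_eq_cube)
        qed
        have "real N \<le> 2 powr (real n * (3 / 8 - 4 * \<beta>) * log 2 (real n))"
          unfolding N_def by (simp add: of_nat_floor)
        also have "\<dots> = (2 powr log 2 (real n)) powr (real n * (3 / 8 - 4 * \<beta>))"
          by (simp add: powr_powr mult.commute)
        also have "\<dots> = real n powr (real n * (3 / 8 - 4 * \<beta>))"
          using n by simp
        finally have N: "real N \<le> real n powr (real n * (3 / 8 - 4 * \<beta>))" .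
        have four: "(4::real) ^ n = 2 ^ n * 2 ^ n"
          by (simp add: power_mult_distrib[symmetric])
        have "real (N * (2 ^ n * (n * p\<^sup>2 + 1) * (2 ^ n * (n * q\<^sup>2 + 1))))
            = real N * (4 ^ n * (real (n * p\<^sup>2 + 1) * real (n * q\<^sup>2 + 1)))"
          by (simp only: four of_nat_mult of_nat_power of_nat_numeral mult_ac)
        also have "\<dots> \<le> real n powr (real n * (3 / 8 - 4 * \<beta>)) * (4 ^ n * (2 * real n ^ 3 * (2 * real n ^ 3)))"
          using N poly[of p] poly[of q] p(2) q(2) elim(9,10)
          by (intro mult_mono) (auto simp: a_def b_def)
        also have "\<dots> \<le> real n powr (real n * (3 / 8 - 4 * \<beta>)) * real n powr (real n * K)"
          using elim(7) by (intro mult_left_mono) (auto simp: power2_eq_square)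
        also have "\<dots> = real n powr ((3 / 8 - 2 * \<beta>) * (real n - \<beta> * real n))"
          by (simp add: powr_add[symmetric] K_def algebra_simps)
        also have "\<dots> \<le> real n powr ((3 / 8 - 2 * \<beta>) * real (n - h))"
          using n h(2) \<open>h \<le> n\<close> assms by (intro powr_mono mult_left_mono) (auto simp: of_nat_diff)
        also have "\<dots> = (a * b) powr real (n - h)"
          by (simp add: a_def b_def powr_add[symmetric] powr_powr)
        also have "\<dots> = (a * b) ^ (n - h)"
          using ab by (intro powr_realpow) (simp add: less_le_trans[OF zero_less_one])
        also have "\<dots> \<le> (real p * real q) ^ (n - h)"
          using p(1) q(1) ab by (intro power_mono mult_mono) auto
        also have "\<dots> = real ((p * q) ^ (n - h))" by simp
        finally show ?thesis by (simp only: of_nat_le_iff)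
      qed
    qed (use assms pq h \<open>h \<le> n\<close> in \<open>auto simp: l_def\<close>)
    then show ?case unfolding N_def .
  qed
qed

theorem theorem3:
  fixes \<sigma> P :: real
  assumes "\<sigma> > 0" and "P > 0"
  shows "DI_capacity \<sigma> P \<ge> ereal (3 / 8)"
proof (rule ereal_le_epsilon2)
  fix e :: real
  assume "0 < e"
  \<comment> \<open>The first bound keeps \<open>\<beta>\<close> below 1/8, the second keeps the
    rate loss \<open>4 * \<beta>\<close> within \<open>e\<close>.\<close>
  define \<beta> where "\<beta> = min (1 / 16) (e / 4)"
  have "0 < \<beta>" "\<beta> < 1 / 8" "4 * \<beta> \<le> e"
    using \<open>0 < e\<close> by (auto simp: \<beta>_def)
  have "ereal (3 / 8) \<le> ereal (3 / 8 - 4 * \<beta>) + ereal e"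
    using \<open>4 * \<beta> \<le> e\<close> by simp
  also have "ereal (3 / 8 - 4 * \<beta>) \<le> DI_capacity \<sigma> P"
    unfolding DI_capacity_def
    using DI_achievable_galaxy[OF \<open>0 < \<beta>\<close> \<open>\<beta> < 1 / 8\<close> assms] by (intro SUP_upper) simp
  then have "ereal (3 / 8 - 4 * \<beta>) + ereal e \<le> DI_capacity \<sigma> P + ereal e"
    by (rule add_right_mono)
  finally show "ereal (3 / 8) \<le> DI_capacity \<sigma> P + ereal e" .
qed

end
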